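(* Consider the optimization problem (no channel knowledge at the secondary transmitter) $$\max_{\mathbf{t}\in\mathbb{C}^{M}}\ \mathbf{t}^H\mathbf{A}\mathbf{t}\quad\text{s.t. }\Pr\Big\{|\mathbf{r}_k^H\mathbf{H}_k\mathbf{t}|^2\le\frac{\epsilon_k}{\alpha_k}\Big\}\ge1-\delta_k\ (k=1,\ldots,K),\quad \|\mathbf{t}\|_2^2\le P,$$ with data as in the context. Let $$\lambda=\min\Big\{\frac{\epsilon_1}{\alpha_1\log\frac1{\delta_1}},\ldots,\frac{\epsilon_K}{\alpha_K\log\frac1{\delta_K}},\,P\Big\}.$$ Then the problem is equivalent to $\max\{\mathbf{t}^H\mathbf{A}\mathbf{t}:\|\mathbf{t}\|_2^2\le\lambda\}$ (the feasible sets coincide), and an optimal solution is $\mathbf{t}^*=\sqrt{\lambda}\,\mathbf{v}$, where $\mathbf{v}$ is a unit-norm eigenvector of $\mathbf{A}$ corresponding to its largest eigenvalue.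
   Context: $M,K,N_1,\ldots,N_K\ge1$ are integers; $\mathbf{A}\in\mathbb{C}^{M\times M}$ is Hermitian positive semidefinite; $\epsilon_k,\alpha_k,P>0$ and $\delta_k\in(0,1)$ are reals. For each $k$, $\mathbf{H}_k\in\mathbb{C}^{N_k\times M}$ is a random matrix with i.i.d. $\mathcal{CN}(0,1)$ entries (circularly symmetric complex Gaussian, mean zero, variance $1$), and $\mathbf{r}_k\in\mathbb{C}^{N_k}$ is a random vector with $\|\mathbf{r}_k\|_2=1$, independent of $\mathbf{H}_k$; the probability is over both $\mathbf{r}_k$ and $\mathbf{H}_k$. $\log$ is the natural logarithm and $(\cdot)^H$ is conjugate transpose. *)

theory Defs
  imports
    "HOL-Probability.Probability"
    "Jordan_Normal_Form.Char_Poly"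
    "Jordan_Normal_Form.Schur_Decomposition"
begin

unbundle no vec_syntax

definition l2norm :: "complex Matrix.vec \<Rightarrow> real" where
  "l2norm x = L2_set (\<lambda>i. cmod (x $ i)) {..<dim_vec x}"

text \<open>
  The product \<open>x \<bullet>c y\<close> conjugates its \<^emph>\<open>second\<close> argument, so that
  \<open>y\<close> with exponent \<open>H\<close>, times \<open>x\<close>, is \<open>x \<bullet>c y\<close>.
\<close>

definition quad_form :: "complex mat \<Rightarrow> complex Matrix.vec \<Rightarrow> complex" where
  "quad_form A t = (A *\<^sub>v t) \<bullet>c t"

definition hermitian_psd :: "nat \<Rightarrow> complex mat \<Rightarrow> bool" where
  "hermitian_psd m A \<longleftrightarrow> A \<in> carrier_mat m m \<and> mat_adjoint A = A \<and>
     (\<forall>x \<in> carrier_vec m. quad_form A x \<in> \<real> \<and> 0 \<le> Re (quad_form A x))"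

text \<open>Hermitian matrices have real spectrum, so only real eigenvalues are compared.\<close>

definition largest_eigenvalue :: "complex mat \<Rightarrow> real \<Rightarrow> bool" where
  "largest_eigenvalue A \<mu> \<longleftrightarrow> eigenvalue A (complex_of_real \<mu>) \<and>
     (\<forall>\<nu>. eigenvalue A (complex_of_real \<nu>) \<longrightarrow> \<nu> \<le> \<mu>)"

definition unit_top_eigenvector :: "complex mat \<Rightarrow> complex Matrix.vec \<Rightarrow> bool" where
  "unit_top_eigenvector A v \<longleftrightarrow> l2norm v = 1 \<and>
     (\<exists>\<mu>. largest_eigenvalue A \<mu> \<and> eigenvector A v (complex_of_real \<mu>))"

text \<open>
  The law \<open>CN(0,1)\<close>: real and imaginary parts are independent real Gaussians of
  variance \<open>1/2\<close> each (the second argument of \<open>normal_density\<close> is the standard deviation).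
\<close>

definition std_complex_normal :: "'w measure \<Rightarrow> ('w \<Rightarrow> complex) \<Rightarrow> bool" where
  "std_complex_normal \<Omega> Z \<longleftrightarrow>
     distributed \<Omega> lborel (\<lambda>\<omega>. Re (Z \<omega>)) (normal_density 0 (sqrt (1/2))) \<and>
     distributed \<Omega> lborel (\<lambda>\<omega>. Im (Z \<omega>)) (normal_density 0 (sqrt (1/2))) \<and>
     prob_space.indep_var \<Omega> borel (\<lambda>\<omega>. Re (Z \<omega>)) borel (\<lambda>\<omega>. Im (Z \<omega>))"

definition iid_CN_matrix :: "'w measure \<Rightarrow> nat \<Rightarrow> nat \<Rightarrow> ('w \<Rightarrow> complex mat) \<Rightarrow> bool" where
  "iid_CN_matrix \<Omega> n m H \<longleftrightarrow>
     (\<forall>\<omega> \<in> space \<Omega>. H \<omega> \<in> carrier_mat n m) \<and>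
     prob_space.indep_vars \<Omega> (\<lambda>_. borel) (\<lambda>ij \<omega>. H \<omega> $$ ij) ({..<n} \<times> {..<m}) \<and>
     (\<forall>ij \<in> {..<n} \<times> {..<m}. std_complex_normal \<Omega> (\<lambda>\<omega>. H \<omega> $$ ij))"

definition random_unit_vec :: "'w measure \<Rightarrow> nat \<Rightarrow> ('w \<Rightarrow> complex Matrix.vec) \<Rightarrow> bool" where
  "random_unit_vec \<Omega> n r \<longleftrightarrow>
     (\<forall>\<omega> \<in> space \<Omega>. r \<omega> \<in> carrier_vec n) \<and>
     (\<forall>i < n. (\<lambda>\<omega>. r \<omega> $ i) \<in> borel_measurable \<Omega>) \<and>
     (AE \<omega> in \<Omega>. l2norm (r \<omega>) = 1)"

text \<open>
  Matrices and vectors carry no sigma-algebra in the library; independence is that of the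
  sigma-algebras generated by the families of entries, as random elements of finite products of
  the Borel space. (The library's \<open>indep_var\<close> would need both families to have the same type.)
\<close>

definition indep_vec_mat ::
  "'w measure \<Rightarrow> nat \<Rightarrow> nat \<Rightarrow> ('w \<Rightarrow> complex Matrix.vec) \<Rightarrow> ('w \<Rightarrow> complex mat) \<Rightarrow> bool" where
  "indep_vec_mat \<Omega> n m r H \<longleftrightarrow> prob_space.indep_set \<Omega>
     (sets (vimage_algebra (space \<Omega>) (\<lambda>\<omega>. \<lambda>i \<in> {..<n}. r \<omega> $ i)
        (PiM {..<n} (\<lambda>_. borel))))
     (sets (vimage_algebra (space \<Omega>) (\<lambda>\<omega>. \<lambda>ij \<in> {..<n} \<times> {..<m}. H \<omega> $$ ij)
        (PiM ({..<n} \<times> {..<m}) (\<lambda>_. borel))))"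

definition feasible_set ::
  "'w measure \<Rightarrow> nat \<Rightarrow> nat \<Rightarrow> (nat \<Rightarrow> 'w \<Rightarrow> complex Matrix.vec) \<Rightarrow> (nat \<Rightarrow> 'w \<Rightarrow> complex mat) \<Rightarrow>
   (nat \<Rightarrow> real) \<Rightarrow> (nat \<Rightarrow> real) \<Rightarrow> (nat \<Rightarrow> real) \<Rightarrow> real \<Rightarrow> complex Matrix.vec set" where
  "feasible_set \<Omega> m K r H \<epsilon> \<alpha> \<delta> P = {t \<in> carrier_vec m.
     (\<forall>k \<in> {1..K}. \<P>(\<omega> in \<Omega>. (cmod ((H k \<omega> *\<^sub>v t) \<bullet>c r k \<omega>))\<^sup>2 \<le> \<epsilon> k / \<alpha> k) \<ge> 1 - \<delta> k) \<and>
     (l2norm t)\<^sup>2 \<le> P}"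

end

theory Submission
  imports
    Defs
    "HOL-Real_Asymp.Real_Asymp"
    "Jordan_Normal_Form.Spectral_Radius"
begin

text \<open>
  For fixed \<open>\<rho>\<close> and \<open>t\<close> the quantity \<open>\<rho>\<close>-conjugate-transpose times \<open>H t\<close> is a linear
  combination of independent \<open>CN(0,1)\<close> entries with weights \<open>cnj \<rho>\<^sub>i * t\<^sub>j\<close>. By rotation
  invariance of the Gaussian it has the law of \<open>\<parallel>\<rho>\<parallel> \<parallel>t\<parallel> Z\<close> with \<open>Z\<close> distributed as
  \<open>CN(0,1)\<close>. Since \<open>r\<close> is independent of \<open>H\<close> and of norm \<open>1\<close>, Fubini shows that the constrained
  power exceeds \<open>c\<close> with probability \<open>exp (- c / \<parallel>t\<parallel>\<^sup>2)\<close>, so each chance constraint is a bound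
  on \<open>\<parallel>t\<parallel>\<^sup>2\<close>. What remains is the Rayleigh quotient bound for a Hermitian positive
  semidefinite matrix.
\<close>

unbundle no vec_syntax

section \<open>The circularly symmetric complex Gaussian\<close>

text \<open>For nonzero \<open>a\<close> the rotation is a composition of affine substitutions in
  one coordinate at a time, with Fubini in between; their scale factors \<open>1 / a\<close> and
  \<open>a\<close> cancel. For \<open>a = 0\<close> it is a coordinate swap up to signs.\<close>

lemma nn_integral_lborel_rotate:
  fixes a b :: real and h :: "real \<Rightarrow> real \<Rightarrow> ennreal"
  assumes h[measurable]: "case_prod h \<in> borel_measurable (borel \<Otimes>\<^sub>M borel)" and ab: "a\<^sup>2 + b\<^sup>2 = 1"
  shows "(\<integral>\<^sup>+x. \<integral>\<^sup>+y. h (a * x - b * y) (b * x + a * y) \<partial>lborel \<partial>lborel) = (\<integral>\<^sup>+x. \<integral>\<^sup>+y. h x y \<partial>lborel \<partial>lborel)"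
proof (cases "a = 0")
  case True
  with ab have b: "b * b = 1" "\<bar>b\<bar> = 1" "b \<noteq> 0"
    by (auto simp: power2_eq_square abs_square_eq_1[symmetric])
  have "(\<integral>\<^sup>+x. \<integral>\<^sup>+y. h x y \<partial>lborel \<partial>lborel) = (\<integral>\<^sup>+x. \<integral>\<^sup>+y. h x (b * y) \<partial>lborel \<partial>lborel)"
    using b by (subst nn_integral_real_affine[where c = b and t = 0 and f = "h x" for x]) auto
  also have "\<dots> = (\<integral>\<^sup>+x. \<integral>\<^sup>+y. h (- b * x) (b * y) \<partial>lborel \<partial>lborel)"
    using b by (subst nn_integral_real_affine[where c = "-b" and t = 0]) auto
  also have "\<dots> = (\<integral>\<^sup>+y. \<integral>\<^sup>+x. h (- b * x) (b * y) \<partial>lborel \<partial>lborel)"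
    by (rule lborel_pair.Fubini') simp
  finally show ?thesis using True by simp
next
  case False
  \<comment> \<open>The second coordinate after both substitutions; here
    \<open>a\<^sup>2 + b\<^sup>2 = 1\<close> enters.\<close>
  have id: "b * (a * x - b * y) / a + y / a = b * x + a * y" for x y
  proof -
    have "b * (a * x - b * y) / a + y / a = (a * (b * x) + (1 - b * b) * y) / a"
      using False by (simp add: field_simps)
    also have "1 - b * b = a * a"
      using ab by (simp add: power2_eq_square)
    finally show ?thesis using False by (simp add: add_divide_distrib)
  qed
  \<comment> \<open>With \<open>u\<close> fixed, substitute \<open>v = (b * u + y) / a\<close>;
    after Fubini, with \<open>y\<close> fixed, substitute \<open>u = a * x - b * y\<close>.\<close>
  have "(\<integral>\<^sup>+u. \<integral>\<^sup>+v. h u v \<partial>lborel \<partial>lborel)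
      = (\<integral>\<^sup>+u. ennreal \<bar>1 / a\<bar> * (\<integral>\<^sup>+y. h u (b * u / a + 1 / a * y) \<partial>lborel) \<partial>lborel)"
    using False by (intro nn_integral_cong nn_integral_real_affine) auto
  also have "\<dots> = ennreal \<bar>1 / a\<bar> * (\<integral>\<^sup>+u. \<integral>\<^sup>+y. h u (b * u / a + y / a) \<partial>lborel \<partial>lborel)"
    by (simp add: nn_integral_cmult)
  also have "(\<integral>\<^sup>+u. \<integral>\<^sup>+y. h u (b * u / a + y / a) \<partial>lborel \<partial>lborel)
      = (\<integral>\<^sup>+y. \<integral>\<^sup>+u. h u (b * u / a + y / a) \<partial>lborel \<partial>lborel)"
    by (rule lborel_pair.Fubini') simp
  also have "\<dots> = (\<integral>\<^sup>+y. ennreal \<bar>a\<bar> * (\<integral>\<^sup>+x. h (a * x - b * y) (b * x + a * y) \<partial>lborel) \<partial>lborel)"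
  proof (rule nn_integral_cong)
    fix y :: real
    have "(\<integral>\<^sup>+u. h u (b * u / a + y / a) \<partial>lborel)
        = ennreal \<bar>a\<bar> * (\<integral>\<^sup>+x. h (- (b * y) + a * x) (b * (- (b * y) + a * x) / a + y / a) \<partial>lborel)"
      using False by (intro nn_integral_real_affine) auto
    then show "(\<integral>\<^sup>+u. h u (b * u / a + y / a) \<partial>lborel)
        = ennreal \<bar>a\<bar> * (\<integral>\<^sup>+x. h (a * x - b * y) (b * x + a * y) \<partial>lborel)"
      by (simp add: id)
  qed
  also have "\<dots> = ennreal \<bar>a\<bar> * (\<integral>\<^sup>+y. \<integral>\<^sup>+x. h (a * x - b * y) (b * x + a * y) \<partial>lborel \<partial>lborel)"
    by (intro nn_integral_cmult) simp
  also have "(\<integral>\<^sup>+y. \<integral>\<^sup>+x. h (a * x - b * y) (b * x + a * y) \<partial>lborel \<partial>lborel)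
      = (\<integral>\<^sup>+x. \<integral>\<^sup>+y. h (a * x - b * y) (b * x + a * y) \<partial>lborel \<partial>lborel)"
    by (rule lborel_pair.Fubini') simp
  finally show ?thesis
    using False by (simp add: mult.assoc[symmetric] ennreal_mult[symmetric] abs_mult[symmetric])
qed

section \<open>The real Gaussian of variance 1/2\<close>

definition gauss :: "real measure" where
  "gauss = density lborel (normal_density 0 (sqrt (1/2)))"

lemma normal_density_half: "normal_density 0 (sqrt (1/2)) x = exp (- x\<^sup>2) / sqrt pi"
  by (simp add: normal_density_def)

lemma prob_space_gauss: "prob_space gauss"
  unfolding gauss_def by (rule prob_space_normal_density) simp

lemma sets_gauss [simp, measurable_cong]: "sets gauss = sets borel"
  by (simp add: gauss_def)

lemma space_gauss [simp]: "space gauss = UNIV"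
  by (simp add: gauss_def)

interpretation gauss: prob_space gauss by (rule prob_space_gauss)
interpretation gauss2: pair_prob_space gauss gauss ..

lemma nn_integral_gauss2:
  fixes f :: "real \<Rightarrow> real \<Rightarrow> ennreal"
  assumes f[measurable]: "case_prod f \<in> borel_measurable (borel \<Otimes>\<^sub>M borel)"
  shows "(\<integral>\<^sup>+x. \<integral>\<^sup>+y. f x y \<partial>gauss \<partial>gauss)
     = (\<integral>\<^sup>+x. \<integral>\<^sup>+y. ennreal (exp (- (x\<^sup>2 + y\<^sup>2)) / pi) * f x y \<partial>lborel \<partial>lborel)"
proof -
  have e: "ennreal (exp (- x\<^sup>2) / sqrt pi) * (ennreal (exp (- y\<^sup>2) / sqrt pi) * c)
      = ennreal (exp (- (x\<^sup>2 + y\<^sup>2)) / pi) * c" for x y :: real and c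
    by (simp add: mult.assoc[symmetric] ennreal_mult[symmetric] exp_add[symmetric])
  have "(\<integral>\<^sup>+x. \<integral>\<^sup>+y. f x y \<partial>gauss \<partial>gauss) = (\<integral>\<^sup>+x. ennreal (exp (- x\<^sup>2) / sqrt pi) *
      (\<integral>\<^sup>+y. ennreal (exp (- y\<^sup>2) / sqrt pi) * f x y \<partial>lborel) \<partial>lborel)"
    unfolding gauss_def normal_density_half by (simp add: nn_integral_density)
  also have "\<dots> = (\<integral>\<^sup>+x. \<integral>\<^sup>+y. ennreal (exp (- x\<^sup>2) / sqrt pi) * (ennreal (exp (- y\<^sup>2) / sqrt pi) * f x y) \<partial>lborel \<partial>lborel)"
    by (simp add: nn_integral_cmult)
  finally show ?thesis by (simp only: e)
qed

text \<open>The density of the pair depends only on \<open>x\<^sup>2 + y\<^sup>2\<close>, which a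
  rotation preserves, so it can be absorbed into the integrand of the Lebesgue version.\<close>

lemma nn_integral_gauss_rotate:
  fixes a b :: real and f :: "real \<Rightarrow> real \<Rightarrow> ennreal"
  assumes f[measurable]: "case_prod f \<in> borel_measurable (borel \<Otimes>\<^sub>M borel)" and ab: "a\<^sup>2 + b\<^sup>2 = 1"
  shows "(\<integral>\<^sup>+x. \<integral>\<^sup>+y. f (a * x - b * y) (b * x + a * y) \<partial>gauss \<partial>gauss) = (\<integral>\<^sup>+x. \<integral>\<^sup>+y. f x y \<partial>gauss \<partial>gauss)"
proof -
  have n: "(a * x - b * y)\<^sup>2 + (b * x + a * y)\<^sup>2 = x\<^sup>2 + y\<^sup>2" for x y
  proof -
    have "(a * x - b * y)\<^sup>2 + (b * x + a * y)\<^sup>2 = (a\<^sup>2 + b\<^sup>2) * (x\<^sup>2 + y\<^sup>2)"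
      by (simp add: power2_eq_square algebra_simps)
    then show ?thesis using ab by simp
  qed
  show ?thesis
    using nn_integral_lborel_rotate[OF _ ab, of "\<lambda>x y. ennreal (exp (- (x\<^sup>2 + y\<^sup>2)) / pi) * f x y"]
    by (simp add: nn_integral_gauss2 n)
qed

text \<open>Normalising \<open>(a, b)\<close> makes the rotated coordinate a function of one variable.\<close>

lemma nn_integral_gauss_add:
  fixes a b :: real and f :: "real \<Rightarrow> ennreal"
  assumes f[measurable]: "f \<in> borel_measurable borel"
  shows "(\<integral>\<^sup>+x. \<integral>\<^sup>+y. f (a * x + b * y) \<partial>gauss \<partial>gauss) = (\<integral>\<^sup>+x. f (sqrt (a\<^sup>2 + b\<^sup>2) * x) \<partial>gauss)"
proof (cases "a = 0 \<and> b = 0")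
  case False
  define s where "s = sqrt (a\<^sup>2 + b\<^sup>2)"
  have s: "s \<noteq> 0" "s\<^sup>2 = a\<^sup>2 + b\<^sup>2"
    using False by (auto simp: s_def)
  \<comment> \<open>The rotation lemma has a minus sign in its first coordinate, hence
    \<open>- b / s\<close>: that coordinate times \<open>s\<close> is \<open>a * x + b * y\<close>.
    The test function below ignores the second coordinate, which integrates out with mass 1.\<close>
  have "(a / s)\<^sup>2 + (- b / s)\<^sup>2 = 1"
    using s(1) by (simp add: power_divide add_divide_distrib[symmetric] flip: s(2))
  from nn_integral_gauss_rotate[OF _ this, of "\<lambda>x y. f (s * x)"] s
  show ?thesis using gauss.emeasure_space_1 by (simp add: s_def[symmetric] ring_distribs)
qed (use gauss.emeasure_space_1 in simp)

section \<open>The law CN(0,1) and weighted sums of independent copies\<close>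

definition cgauss :: "complex measure" where
  "cgauss = distr (gauss \<Otimes>\<^sub>M gauss) borel (\<lambda>(x, y). Complex x y)"

lemma borel_measurable_Complex [measurable (raw)]:
  assumes "f \<in> borel_measurable M" "g \<in> borel_measurable M"
  shows "(\<lambda>x. Complex (f x) (g x)) \<in> borel_measurable M"
  unfolding Complex_eq using assms by measurable

lemma sets_cgauss [simp, measurable_cong]: "sets cgauss = sets borel"
  by (simp add: cgauss_def)

lemma space_cgauss [simp]: "space cgauss = UNIV"
  by (simp add: cgauss_def)

lemma prob_space_cgauss: "prob_space cgauss"
  unfolding cgauss_def by (rule gauss2.prob_space_distr) simp

interpretation cgauss: prob_space cgauss by (rule prob_space_cgauss)

lemma nn_integral_cgauss:
  assumes f[measurable]: "f \<in> borel_measurable borel"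
  shows "(\<integral>\<^sup>+z. f z \<partial>cgauss) = (\<integral>\<^sup>+x. \<integral>\<^sup>+y. f (Complex x y) \<partial>gauss \<partial>gauss)"
  unfolding cgauss_def
  by (subst nn_integral_distr) (auto simp: gauss.nn_integral_fst[symmetric] case_prod_beta)

text \<open>Multiplication by a unit complex number is the plane rotation with cosine
  \<open>Re c\<close> and sine \<open>Im c\<close>.\<close>

lemma nn_integral_cgauss_rotate:
  assumes f[measurable]: "f \<in> borel_measurable borel" and c: "cmod c = 1"
  shows "(\<integral>\<^sup>+z. f (c * z) \<partial>cgauss) = (\<integral>\<^sup>+z. f z \<partial>cgauss)"
proof -
  have ab: "(Re c)\<^sup>2 + (Im c)\<^sup>2 = 1" using c by (simp add: cmod_def)
  have "c * Complex x y = Complex (Re c * x - Im c * y) (Im c * x + Re c * y)" for x y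
    by (simp add: complex_eq_iff)
  then show ?thesis
    using nn_integral_gauss_rotate[OF _ ab, of "\<lambda>x y. f (Complex x y)"]
    by (simp add: nn_integral_cgauss)
qed

text \<open>The phase \<open>c / cmod c\<close> is a rotation and drops out, so only the modulus of
  a weight matters.\<close>

lemma nn_integral_cgauss_mult:
  assumes f[measurable]: "f \<in> borel_measurable borel"
  shows "(\<integral>\<^sup>+z. f (c * z) \<partial>cgauss) = (\<integral>\<^sup>+z. f (complex_of_real (cmod c) * z) \<partial>cgauss)"
proof (cases "c = 0")
  case False
  have "(\<integral>\<^sup>+z. f (c * z) \<partial>cgauss) = (\<integral>\<^sup>+z. f (cmod c * (c / cmod c * z)) \<partial>cgauss)"
    using False by simp
  also have "\<dots> = (\<integral>\<^sup>+z. f (cmod c * z) \<partial>cgauss)"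
    using False by (intro nn_integral_cgauss_rotate) (auto simp: norm_divide)
  finally show ?thesis .
qed simp

text \<open>Real weights act on real and imaginary parts separately, so the real addition lemma
  applies once to each.\<close>

lemma nn_integral_cgauss_add_real:
  assumes f[measurable]: "f \<in> borel_measurable borel"
  shows "(\<integral>\<^sup>+z. \<integral>\<^sup>+w. f (complex_of_real a * z + complex_of_real b * w) \<partial>cgauss \<partial>cgauss)
    = (\<integral>\<^sup>+z. f (complex_of_real (sqrt (a\<^sup>2 + b\<^sup>2)) * z) \<partial>cgauss)"
proof -
  let ?s = "sqrt (a\<^sup>2 + b\<^sup>2)"
  have C: "complex_of_real a * Complex x y + complex_of_real b * Complex u v
     = Complex (a * x + b * u) (a * y + b * v)" 
     "complex_of_real a * Complex x y = Complex (a * x) (a * y)" for x y u v a b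
    by (simp_all add: complex_eq_iff)
  have "(\<integral>\<^sup>+z. \<integral>\<^sup>+w. f (complex_of_real a * z + complex_of_real b * w) \<partial>cgauss \<partial>cgauss)
     = (\<integral>\<^sup>+x. \<integral>\<^sup>+y. \<integral>\<^sup>+u. \<integral>\<^sup>+v. f (Complex (a * x + b * u) (a * y + b * v)) \<partial>gauss \<partial>gauss \<partial>gauss \<partial>gauss)"
    by (simp add: nn_integral_cgauss C(1))
  \<comment> \<open>Exchanging \<open>y\<close> and \<open>u\<close> brings the two imaginary parts
    \<open>y\<close> and \<open>v\<close> together innermost and the two real parts \<open>x\<close>
    and \<open>u\<close> together outermost.\<close>
  also have "\<dots> = (\<integral>\<^sup>+x. \<integral>\<^sup>+u. \<integral>\<^sup>+y. \<integral>\<^sup>+v. f (Complex (a * x + b * u) (a * y + b * v)) \<partial>gauss \<partial>gauss \<partial>gauss \<partial>gauss)"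
    by (intro nn_integral_cong gauss2.Fubini') simp
  also have "\<dots> = (\<integral>\<^sup>+x. \<integral>\<^sup>+u. \<integral>\<^sup>+y. f (Complex (a * x + b * u) (?s * y)) \<partial>gauss \<partial>gauss \<partial>gauss)"
    by (intro nn_integral_cong nn_integral_gauss_add) simp
  also have "\<dots> = (\<integral>\<^sup>+x. \<integral>\<^sup>+y. f (Complex (?s * x) (?s * y)) \<partial>gauss \<partial>gauss)"
    by (rule nn_integral_gauss_add) simp
  also have "\<dots> = (\<integral>\<^sup>+z. f (complex_of_real ?s * z) \<partial>cgauss)"
    by (simp add: nn_integral_cgauss C)
  finally show ?thesis .
qed

text \<open>One complex weight is enough for the induction below: the other weight is the real
  square root already accumulated.\<close>

lemma nn_integral_cgauss_add:
  assumes f[measurable]: "f \<in> borel_measurable borel"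
  shows "(\<integral>\<^sup>+z. \<integral>\<^sup>+w. f (c * z + complex_of_real b * w) \<partial>cgauss \<partial>cgauss)
    = (\<integral>\<^sup>+z. f (complex_of_real (sqrt ((cmod c)\<^sup>2 + b\<^sup>2)) * z) \<partial>cgauss)"
proof -
  have "(\<integral>\<^sup>+z. \<integral>\<^sup>+w. f (c * z + complex_of_real b * w) \<partial>cgauss \<partial>cgauss)
    = (\<integral>\<^sup>+z. \<integral>\<^sup>+w. f (cmod c * z + complex_of_real b * w) \<partial>cgauss \<partial>cgauss)"
    by (rule nn_integral_cgauss_mult) simp
  then show ?thesis by (simp add: nn_integral_cgauss_add_real)
qed

text \<open>Induction on the index set, merging one summand at a time. \<open>f\<close> is
  generalised because the hypothesis is applied to \<open>f\<close> translated by the new term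
  \<open>w i * y\<close>.\<close>

lemma nn_integral_PiM_cgauss_sum:
  assumes "finite I" and f: "f \<in> borel_measurable borel"
  shows "(\<integral>\<^sup>+z. f (\<Sum>i\<in>I. w i * z i) \<partial>(\<Pi>\<^sub>M i\<in>I. cgauss))
    = (\<integral>\<^sup>+z. f (complex_of_real (sqrt (\<Sum>i\<in>I. (cmod (w i))\<^sup>2)) * z) \<partial>cgauss)"
  using assms
proof (induction I arbitrary: f)
  case empty
  interpret product_sigma_finite "\<lambda>_. cgauss" ..
  show ?case using cgauss.emeasure_space_1 by (simp add: nn_integral_empty space_PiM PiM_empty)
next
  case (insert i I)
  interpret product_sigma_finite "\<lambda>_. cgauss" ..
  note [measurable] = insert.prems
  let ?s = "\<Sum>i\<in>I. (cmod (w i))\<^sup>2"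
  have "(\<Sum>j\<in>insert i I. w j * (z(i := y)) j) = w i * y + (\<Sum>j\<in>I. w j * z j)" for z y
    using insert.hyps by (auto intro!: sum.cong)
  then have "(\<integral>\<^sup>+z. f (\<Sum>i\<in>insert i I. w i * z i) \<partial>(\<Pi>\<^sub>M i\<in>insert i I. cgauss))
     = (\<integral>\<^sup>+y. \<integral>\<^sup>+z. f (w i * y + (\<Sum>i\<in>I. w i * z i)) \<partial>(\<Pi>\<^sub>M i\<in>I. cgauss) \<partial>cgauss)"
    using insert.hyps by (subst product_nn_integral_insert_rev) (auto simp del: fun_upd_apply)
  also have "\<dots> = (\<integral>\<^sup>+y. \<integral>\<^sup>+z. f (w i * y + complex_of_real (sqrt ?s) * z) \<partial>cgauss \<partial>cgauss)"
    by (intro nn_integral_cong insert.IH) simp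
  also have "\<dots> = (\<integral>\<^sup>+z. f (complex_of_real (sqrt ((cmod (w i))\<^sup>2 + (sqrt ?s)\<^sup>2)) * z) \<partial>cgauss)"
    by (rule nn_integral_cgauss_add) simp
  finally show ?case using insert.hyps by (simp add: sum_nonneg)
qed

section \<open>The exponential tail of the squared modulus\<close>

text \<open>A difference of two concentric disks. In terms of squared radii the area is linear,
  which produces the factor \<open>u - c\<close> in the tail integral.\<close>

lemma emeasure_annulus:
  assumes "0 \<le> c" "c \<le> u"
  shows "emeasure lborel {p :: real \<times> real. c < (norm p)\<^sup>2 \<and> (norm p)\<^sup>2 \<le> u} = ennreal (pi * (u - c))"
proof -
  have le: "norm p \<le> sqrt x \<longleftrightarrow> (norm p)\<^sup>2 \<le> x" if "0 \<le> x" for p :: "real \<times> real" and x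
    using power_mono[of "norm p" "sqrt x" 2] that by (auto intro: real_le_rsqrt)
  have eq: "{p :: real \<times> real. c < (norm p)\<^sup>2 \<and> (norm p)\<^sup>2 \<le> u} = cball 0 (sqrt u) - cball 0 (sqrt c)"
    using assms by (auto simp: le not_le[symmetric])
  have "emeasure lborel (cball (0 :: real \<times> real) (sqrt x)) = ennreal (pi * x)" if "0 \<le> x" for x
    using that by (simp add: emeasure_cball unit_ball_vol_2 power2_eq_square[symmetric] numeral_2_eq_2[symmetric])
  moreover have "cball 0 (sqrt c) \<subseteq> cball (0 :: real \<times> real) (sqrt u)"
    using assms by (intro subset_cball) simp
  ultimately show ?thesis
    using assms unfolding eq by (subst emeasure_Diff) (auto simp: ennreal_minus ring_distribs)
qed

text \<open>The layer-cake formula \<open>exp (- \<rho>) = \<integral>\<^sub>\<rho> exp (- u) du\<close> reduces the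
  integral over the plane to areas of annuli, which replaces polar coordinates.\<close>

lemma emeasure_cgauss_tail:
  assumes c: "0 \<le> c"
  shows "emeasure cgauss {z. c < (cmod z)\<^sup>2} = ennreal (exp (- c))"
proof -
  \<comment> \<open>Limits at infinity of antiderivatives of \<open>exp (- u)\<close> and of
    \<open>(u - c) * exp (- u)\<close>. The second antiderivative equals \<open>- exp (- c)\<close>
    at \<open>u = c\<close>, which gives the final value.\<close>
  have lim: "((\<lambda>u. - exp (- u)) \<longlongrightarrow> (0 :: real)) at_top" 
    "((\<lambda>u. - (u - c + 1) * exp (- u)) \<longlongrightarrow> (0 :: real)) at_top"
    by real_asymp+
  have lc: "ennreal (exp (- r)) = (\<integral>\<^sup>+u. ennreal (exp (- u)) * indicator {r ..} u \<partial>lborel)" for r :: real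
    by (subst nn_integral_FTC_atLeast[OF _ _ _ lim(1)]) (auto intro!: derivative_eq_intros)
  have n: "(norm (x, y))\<^sup>2 = x\<^sup>2 + y\<^sup>2" "(cmod (Complex x y))\<^sup>2 = x\<^sup>2 + y\<^sup>2" for x y :: real
    by (simp_all add: norm_Pair cmod_def)
  have "emeasure cgauss {z. c < (cmod z)\<^sup>2} = (\<integral>\<^sup>+z. indicator {z. c < (cmod z)\<^sup>2} z \<partial>cgauss)"
    by simp
  also have "\<dots> = (\<integral>\<^sup>+x. \<integral>\<^sup>+y. ennreal (exp (- (x\<^sup>2 + y\<^sup>2)) / pi) * indicator {z. c < (cmod z)\<^sup>2} (Complex x y) \<partial>lborel \<partial>lborel)"
    by (subst nn_integral_cgauss, simp, subst nn_integral_gauss2) simp_all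
  also have "\<dots> = (\<integral>\<^sup>+x. \<integral>\<^sup>+y. ennreal (exp (- (norm (x, y))\<^sup>2) / pi) * indicator {p :: real \<times> real. c < (norm p)\<^sup>2} (x, y) \<partial>lborel \<partial>lborel)"
    by (intro nn_integral_cong) (simp add: n indicator_def)
  also have "\<dots> = (\<integral>\<^sup>+p. ennreal (exp (- (norm p)\<^sup>2) / pi) * indicator {p. c < (norm p)\<^sup>2} p \<partial>(lborel :: (real \<times> real) measure))"
    unfolding lborel_prod[symmetric] by (rule lborel.nn_integral_fst) (unfold lborel_prod, measurable)
  also have "\<dots> = (\<integral>\<^sup>+p. \<integral>\<^sup>+u. ennreal (exp (- u) / pi) * indicator {p. c < (norm p)\<^sup>2 \<and> (norm p)\<^sup>2 \<le> u} p \<partial>lborel \<partial>(lborel :: (real \<times> real) measure))"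
  proof (rule nn_integral_cong)
    fix p :: "real \<times> real"
    have "ennreal (exp (- (norm p)\<^sup>2) / pi) * indicator {p. c < (norm p)\<^sup>2} p
       = ennreal (1 / pi) * indicator {p. c < (norm p)\<^sup>2} p * ennreal (exp (- (norm p)\<^sup>2))"
      by (simp add: ennreal_mult[symmetric] mult_ac split: split_indicator)
    also have "\<dots> = (\<integral>\<^sup>+u. ennreal (1 / pi) * indicator {p. c < (norm p)\<^sup>2} p * (ennreal (exp (- u)) * indicator {(norm p)\<^sup>2 ..} u) \<partial>lborel)"
      by (subst nn_integral_cmult) (simp_all add: lc[of "(norm p)\<^sup>2"])
    also have "\<dots> = (\<integral>\<^sup>+u. ennreal (exp (- u) / pi) * indicator {p. c < (norm p)\<^sup>2 \<and> (norm p)\<^sup>2 \<le> u} p \<partial>lborel)"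
      by (intro nn_integral_cong) (auto simp: ennreal_mult[symmetric] mult_ac split: split_indicator)
    finally show "ennreal (exp (- (norm p)\<^sup>2) / pi) * indicator {p. c < (norm p)\<^sup>2} p = \<dots>" .
  qed
  \<comment> \<open>After the exchange the weight is constant in \<open>p\<close>, so the inner
    integral is that weight times the area of an annulus; the factors \<open>pi\<close>
    cancel.\<close>
  also have "\<dots> = (\<integral>\<^sup>+u. \<integral>\<^sup>+p. ennreal (exp (- u) / pi) * indicator {p. c < (norm p)\<^sup>2 \<and> (norm p)\<^sup>2 \<le> u} p \<partial>(lborel :: (real \<times> real) measure) \<partial>lborel)"
    by (rule lborel_pair.Fubini') simp
  also have "\<dots> = (\<integral>\<^sup>+u. ennreal ((u - c) * exp (- u)) * indicator {c ..} u \<partial>lborel)"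
  proof (rule nn_integral_cong)
    fix u :: real
    \<comment> \<open>The area formula requires \<open>c \<le> u\<close>; below \<open>c\<close> the
      region is empty and the indicator vanishes.\<close>
    have "{p :: real \<times> real. c < (norm p)\<^sup>2 \<and> (norm p)\<^sup>2 \<le> u} = {}" if "u < c" using that by auto
    then show "(\<integral>\<^sup>+p. ennreal (exp (- u) / pi) * indicator {p. c < (norm p)\<^sup>2 \<and> (norm p)\<^sup>2 \<le> u} p \<partial>(lborel :: (real \<times> real) measure))
      = ennreal ((u - c) * exp (- u)) * indicator {c ..} u"
      using c by (cases "u < c") (auto simp: nn_integral_cmult emeasure_annulus ennreal_mult[symmetric] mult_ac)
  qed
  also have "\<dots> = ennreal (exp (- c))"
  proof (subst nn_integral_FTC_atLeast[OF _ _ _ lim(2)])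
    show "((\<lambda>u. - (u - c + 1) * exp (- u)) has_real_derivative (u - c) * exp (- u)) (at u)" for u
      by (rule derivative_eq_intros refl)+ (simp add: ring_distribs)
  qed simp_all
  finally show ?thesis .
qed

section \<open>The Rayleigh quotient of a positive semidefinite matrix\<close>

lemma cscalar_prod_eq_sum:
  assumes "x \<in> carrier_vec n" "y \<in> carrier_vec n"
  shows "x \<bullet>c y = (\<Sum>i<n. x $ i * cnj (y $ i))"
  using assms by (auto simp: scalar_prod_def atLeast0LessThan)

lemma l2norm_nonneg [simp]: "0 \<le> l2norm x"
  by (simp add: l2norm_def)

lemma cscalar_prod_self:
  assumes "x \<in> carrier_vec n"
  shows "x \<bullet>c x = complex_of_real ((l2norm x)\<^sup>2)"
  using assms
  by (simp add: cscalar_prod_eq_sum l2norm_def L2_set_def sum_nonneg complex_norm_square del: of_real_power)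

lemma l2norm_eq_0_iff:
  assumes "x \<in> carrier_vec n"
  shows "l2norm x = 0 \<longleftrightarrow> x = 0\<^sub>v n"
  using assms by (auto simp: l2norm_def L2_set_eq_0_iff)

lemma l2norm_smult [simp]: "l2norm (c \<cdot>\<^sub>v x) = cmod c * l2norm x"
  by (simp add: l2norm_def norm_mult L2_set_right_distrib cong: L2_set_cong_simp)

lemma cscalar_prod_Cauchy_Schwarz:
  assumes "x \<in> carrier_vec n" "y \<in> carrier_vec n"
  shows "cmod (x \<bullet>c y) \<le> l2norm x * l2norm y"
proof -
  have "cmod (x \<bullet>c y) \<le> (\<Sum>i<n. \<bar>cmod (x $ i)\<bar> * \<bar>cmod (y $ i)\<bar>)"
    unfolding cscalar_prod_eq_sum[OF assms] by (rule sum_norm_le) (simp add: norm_mult)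
  also have "\<dots> \<le> L2_set (\<lambda>i. cmod (x $ i)) {..<n} * L2_set (\<lambda>i. cmod (y $ i)) {..<n}"
    by (rule L2_set_mult_ineq)
  finally show ?thesis using assms by (simp add: l2norm_def)
qed

lemma mat_adjoint_index:
  assumes "i < dim_col A" "j < dim_row A"
  shows "mat_adjoint A $$ (i, j) = conjugate (A $$ (j, i))"
  using assms by (simp add: mat_adjoint_def mat_of_rows_def)

lemma cscalar_prod_hermitian:
  fixes A :: "complex mat"
  assumes A: "A \<in> carrier_mat n n" "mat_adjoint A = A" and x: "x \<in> carrier_vec n" and y: "y \<in> carrier_vec n"
  shows "(A *\<^sub>v x) \<bullet>c y = x \<bullet>c (A *\<^sub>v y)"
proof -
  have h: "A $$ (i, j) = cnj (A $$ (j, i))" if "i < n" "j < n" for i j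
    using mat_adjoint_index[of i A j] A that by simp
  have m: "(A *\<^sub>v z) $ i = (\<Sum>j<n. A $$ (i, j) * z $ j)" if "i < n" "z \<in> carrier_vec n" for i z
    using A that by (simp add: scalar_prod_def atLeast0LessThan)
  have "(A *\<^sub>v x) \<bullet>c y = (\<Sum>i<n. \<Sum>j<n. A $$ (i, j) * x $ j * cnj (y $ i))"
    using A x y by (subst cscalar_prod_eq_sum[of _ n]) (simp_all add: m sum_distrib_right del: index_mult_mat_vec)
  also have "\<dots> = (\<Sum>j<n. \<Sum>i<n. A $$ (i, j) * x $ j * cnj (y $ i))"
    by (rule sum.swap)
  also have "\<dots> = (\<Sum>j<n. x $ j * cnj ((A *\<^sub>v y) $ j))"
  proof (rule sum.cong)
    fix j assume j: "j \<in> {..<n}"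
    have "cnj ((A *\<^sub>v y) $ j) = (\<Sum>i<n. A $$ (i, j) * cnj (y $ i))"
      using y j by (auto simp: m h[of _ j] simp del: index_mult_mat_vec intro!: sum.cong)
    then show "(\<Sum>i<n. A $$ (i, j) * x $ j * cnj (y $ i)) = x $ j * cnj ((A *\<^sub>v y) $ j)"
      by (simp add: sum_distrib_left mult_ac)
  qed simp
  also have "\<dots> = x \<bullet>c (A *\<^sub>v y)"
    using A x y by (subst cscalar_prod_eq_sum[of _ n]) simp_all
  finally show ?thesis .
qed

lemma smult_mat_mult_vec:
  fixes A :: "'a :: comm_ring_1 mat"
  assumes "A \<in> carrier_mat nr nc" "v \<in> carrier_vec nc"
  shows "(k \<cdot>\<^sub>m A) *\<^sub>v v = k \<cdot>\<^sub>v (A *\<^sub>v v)"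
  using assms by (intro eq_vecI) (auto simp: scalar_prod_def sum_distrib_left mult.assoc)

section \<open>Growth of powers of a Hermitian matrix\<close>

text \<open>A crude estimate suffices: the right-hand side depends on \<open>A\<close> only through
  the entry bound \<open>c\<close>, so it is uniform over all powers sharing that bound.\<close>

lemma l2norm_mult_mat_vec_norm_bound:
  assumes A: "A \<in> carrier_mat n n" "norm_bound A c" and x: "x \<in> carrier_vec n"
  shows "l2norm (A *\<^sub>v x) \<le> (\<Sum>i<n. \<Sum>j<n. c * cmod (x $ j))"
proof -
  have "l2norm (A *\<^sub>v x) \<le> (\<Sum>i<n. cmod ((A *\<^sub>v x) $ i))"
    using A L2_set_le_sum[of "{..<n}" "\<lambda>i. cmod ((A *\<^sub>v x) $ i)"]
    by (simp add: l2norm_def del: index_mult_mat_vec)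
  also have "\<dots> \<le> (\<Sum>i<n. \<Sum>j<n. c * cmod (x $ j))"
  proof (rule sum_mono)
    fix i assume i: "i \<in> {..<n}"
    have "cmod ((A *\<^sub>v x) $ i) = cmod (\<Sum>j<n. A $$ (i, j) * x $ j)"
      using A x i by (simp add: scalar_prod_def atLeast0LessThan)
    also have "\<dots> \<le> (\<Sum>j<n. c * cmod (x $ j))"
      using A i by (intro sum_norm_le) (auto simp: norm_mult norm_bound_def intro!: mult_right_mono)
    finally show "cmod ((A *\<^sub>v x) $ i) \<le> (\<Sum>j<n. c * cmod (x $ j))" .
  qed
  finally show ?thesis .
qed

text \<open>For Hermitian \<open>A\<close> the sequence \<open>\<parallel>A\<^sup>k x\<parallel>\<close> is log-convex, so one
  expanding step would force exponential growth; a spectral radius below \<open>1\<close> excludes this.\<close>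

lemma hermitian_contraction:
  fixes A :: "complex mat"
  assumes A: "A \<in> carrier_mat n n" "mat_adjoint A = A" and sr: "spectral_radius A < 1"
    and x: "x \<in> carrier_vec n"
  shows "l2norm (A *\<^sub>v x) \<le> l2norm x"
proof (rule ccontr)
  assume "\<not> ?thesis"
  then have gt: "l2norm x < l2norm (A *\<^sub>v x)" by simp
  define y where "y k = A ^\<^sub>m k *\<^sub>v x" for k
  have y: "y k \<in> carrier_vec n" for k
    unfolding y_def by (intro mult_mat_vec_carrier[OF pow_carrier_mat[OF A(1)]] x)
  have y_Suc: "y (Suc k) = A *\<^sub>v y k" for k
  proof -
    \<comment> \<open>Powers append their new factor on the right, whereas iterating
      \<open>A\<close> on a vector needs it on the left.\<close>
    have "A ^\<^sub>m Suc k = A * A ^\<^sub>m k"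
    proof (induction k)
      case (Suc k)
      have "A ^\<^sub>m Suc (Suc k) = (A * A ^\<^sub>m k) * A"
        using Suc by simp
      also have "\<dots> = A * A ^\<^sub>m Suc k"
        using assoc_mult_mat[OF A(1) pow_carrier_mat[OF A(1)] A(1)] by simp
      finally show ?case .
    qed (use A in simp)
    then show ?thesis
      unfolding y_def using assoc_mult_mat_vec[OF A(1) pow_carrier_mat[OF A(1)] x] by simp
  qed
  have y0: "y 0 = x" using A x by (simp add: y_def)
  have x0: "0 < l2norm x"
  proof -
    have "x \<noteq> 0\<^sub>v n"
    proof
      assume "x = 0\<^sub>v n"
      then have "A *\<^sub>v x = 0\<^sub>v n" using A by auto
      with gt \<open>x = 0\<^sub>v n\<close> show False by simp
    qed
    then show ?thesis using l2norm_eq_0_iff[OF x] l2norm_nonneg[of x] by linarith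
  qed
  define q where "q = l2norm (A *\<^sub>v x) / l2norm x"
  have q: "1 < q" using gt x0 by (simp add: q_def)
  \<comment> \<open>Self-adjointness moves one factor \<open>A\<close> across the inner product,
    shifting the indices from (k+1, k+1) to (k+2, k); then Cauchy-Schwarz.\<close>
  have log_convex: "(l2norm (y (Suc k)))\<^sup>2 \<le> l2norm (y (Suc (Suc k))) * l2norm (y k)" for k
  proof -
    have "(l2norm (y (Suc k)))\<^sup>2 = cmod (y (Suc k) \<bullet>c (A *\<^sub>v y k))"
      using cscalar_prod_self[OF y] by (simp add: y_Suc[symmetric] norm_power)
    also have "\<dots> = cmod (y (Suc (Suc k)) \<bullet>c y k)"
      using cscalar_prod_hermitian[OF A y y] by (simp add: y_Suc[of "Suc k"])
    also have "\<dots> \<le> l2norm (y (Suc (Suc k))) * l2norm (y k)"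
      by (rule cscalar_prod_Cauchy_Schwarz[OF y y])
    finally show ?thesis .
  qed
  \<comment> \<open>By log-convexity successive ratios never fall below the first one,
    \<open>q\<close>. Positivity is carried along so that \<open>l2norm (y k)\<close> can be
    cancelled.\<close>
  have grow: "0 < l2norm (y k) \<and> q * l2norm (y k) \<le> l2norm (y (Suc k))" for k
  proof (induction k)
    case 0
    show ?case using x0 by (simp add: y0 y_Suc q_def)
  next
    case (Suc k)
    then have pos: "0 < l2norm (y (Suc k))"
      using q mult_pos_pos[of q "l2norm (y k)"] by linarith
    have "l2norm (y (Suc k)) * (q * l2norm (y k)) \<le> l2norm (y (Suc k)) * l2norm (y (Suc k))"
      using Suc by (intro mult_left_mono) auto
    also have "\<dots> \<le> l2norm (y (Suc (Suc k))) * l2norm (y k)"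
      using log_convex[of k] by (simp add: power2_eq_square)
    finally have "q * l2norm (y (Suc k)) * l2norm (y k) \<le> l2norm (y (Suc (Suc k))) * l2norm (y k)"
      by (simp add: mult_ac)
    then show ?case using Suc pos by simp
  qed
  have lower: "q ^ k * l2norm x \<le> l2norm (y k)" for k
  proof (induction k)
    case (Suc k)
    have "q ^ Suc k * l2norm x = q * (q ^ k * l2norm x)" by simp
    also have "\<dots> \<le> q * l2norm (y k)" using Suc q by (intro mult_left_mono) auto
    finally show ?case using grow[of k] by linarith
  qed (simp add: y0)
  \<comment> \<open>Spectral radius below 1 bounds the entries of all powers at once, which the
    geometric growth with ratio \<open>q > 1\<close> contradicts.\<close>
  obtain c where c: "\<And>k. norm_bound (A ^\<^sub>m k) c"
    using spectral_radius_jnf_norm_bound_less_1_upper_triangular[OF A(1) sr] by blast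
  have upper: "l2norm (y k) \<le> (\<Sum>i<n. \<Sum>j<n. c * cmod (x $ j))" for k
    unfolding y_def using A x c by (intro l2norm_mult_mat_vec_norm_bound) auto
  obtain k where "(\<Sum>i<n. \<Sum>j<n. c * cmod (x $ j)) / l2norm x < q ^ k"
    using real_arch_pow[OF q] by blast
  then have "(\<Sum>i<n. \<Sum>j<n. c * cmod (x $ j)) < q ^ k * l2norm x"
    using x0 by (simp add: field_simps)
  with lower[of k] upper[of k] show False by linarith
qed

section \<open>Eigenvalues of a positive semidefinite matrix\<close>

text \<open>The eigenvalue is the quotient of the quadratic form, real and nonnegative, by the
  positive squared norm of the eigenvector.\<close>

lemma hermitian_psd_eigenvector:
  assumes "hermitian_psd n A" "eigenvector A v k"
  shows "v \<in> carrier_vec n" "0 < l2norm v" "quad_form A v = k * complex_of_real ((l2norm v)\<^sup>2)"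
    "k \<in> \<real>" "0 \<le> Re k"
proof -
  have A: "A \<in> carrier_mat n n"
    using assms by (simp add: hermitian_psd_def)
  have v: "v \<in> carrier_vec n" "v \<noteq> 0\<^sub>v n" and Av: "A *\<^sub>v v = k \<cdot>\<^sub>v v"
    using assms(2) A by (auto simp: eigenvector_def)
  show "v \<in> carrier_vec n" by fact
  show pos: "0 < l2norm v"
    using v l2norm_eq_0_iff[of v n] l2norm_nonneg[of v] by linarith
  show q: "quad_form A v = k * complex_of_real ((l2norm v)\<^sup>2)"
    using v cscalar_prod_self[OF v(1)] by (simp add: quad_form_def Av)
  have real: "quad_form A v \<in> \<real>" "0 \<le> Re (quad_form A v)"
    using assms(1) v by (auto simp: hermitian_psd_def)
  have k: "k = quad_form A v / complex_of_real ((l2norm v)\<^sup>2)"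
    using pos q by simp
  show "k \<in> \<real>"
    using real(1) unfolding k by (intro Reals_divide Reals_of_real)
  show "0 \<le> Re k"
    using real(2) unfolding k Re_divide_of_real by simp
qed

text \<open>The spectrum is finite, and nonempty for \<open>n > 0\<close>. All eigenvalues being
  real, the set of real eigenvalues inherits both and has a maximum.\<close>

lemma hermitian_psd_largest_eigenvalue_exists:
  assumes A: "hermitian_psd n A" and n: "n > 0"
  shows "\<exists>\<mu>. largest_eigenvalue A \<mu>"
proof -
  have carrier: "A \<in> carrier_mat n n"
    using A by (simp add: hermitian_psd_def)
  let ?S = "{\<nu>. eigenvalue A (complex_of_real \<nu>)}"
  have "finite (complex_of_real ` ?S)"
    by (rule finite_subset[OF _ card_finite_spectrum(1)[OF carrier]]) (auto simp: spectrum_def)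
  then have fin: "finite ?S"
    by (rule finite_imageD) (simp add: inj_on_def)
  obtain k v where k: "eigenvector A v k"
    using spectrum_non_empty[OF carrier n] by (auto simp: spectrum_def eigenvalue_def)
  then have "Re k \<in> ?S"
    using hermitian_psd_eigenvector(4)[OF A k] by (auto simp: eigenvalue_def)
  then have "Max ?S \<in> ?S" using fin by (intro Max_in) auto
  with fin show ?thesis
    by (auto simp: largest_eigenvalue_def intro!: exI[of _ "Max ?S"])
qed

lemma unit_top_eigenvector_exists:
  assumes A: "hermitian_psd n A" and n: "n > 0"
  shows "\<exists>v. unit_top_eigenvector A v"
proof -
  obtain \<mu> where \<mu>: "largest_eigenvalue A \<mu>"
    using hermitian_psd_largest_eigenvalue_exists[OF assms] by blast
  then obtain v where v: "eigenvector A v (complex_of_real \<mu>)"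
    by (auto simp: largest_eigenvalue_def eigenvalue_def)
  have carrier: "A \<in> carrier_mat n n"
    using A by (simp add: hermitian_psd_def)
  note e = hermitian_psd_eigenvector[OF A v]
  define u where "u = complex_of_real (1 / l2norm v) \<cdot>\<^sub>v v"
  have "A *\<^sub>v u = complex_of_real \<mu> \<cdot>\<^sub>v u"
    using v carrier e(1) unfolding u_def
    by (simp add: mult_mat_vec eigenvector_def smult_smult_assoc mult.commute)
  moreover have u: "l2norm u = 1" "u \<in> carrier_vec n"
    using e by (auto simp: u_def norm_divide)
  moreover from u have "u \<noteq> 0\<^sub>v n"
    using l2norm_eq_0_iff[of u n] by auto
  ultimately have "unit_top_eigenvector A u"
    using \<mu> carrier by (auto simp: unit_top_eigenvector_def eigenvector_def)
  then show ?thesis by blast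
qed

section \<open>The Rayleigh bound and its maximiser\<close>

text \<open>For \<open>\<rho> > \<mu>\<close> the matrix \<open>A\<close> divided by
  \<open>\<rho>\<close> has spectral radius below 1 and is therefore a contraction; then
  \<open>\<rho>\<close> tends to \<open>\<mu>\<close>. Approaching from above also covers
  \<open>\<mu> = 0\<close>.\<close>

lemma hermitian_psd_l2norm_le:
  assumes A: "hermitian_psd n A" and n: "n > 0" and \<mu>: "largest_eigenvalue A \<mu>" and x: "x \<in> carrier_vec n"
  shows "l2norm (A *\<^sub>v x) \<le> \<mu> * l2norm x"
proof -
  have carrier: "A \<in> carrier_mat n n" and adj: "mat_adjoint A = A"
    using A by (simp_all add: hermitian_psd_def)
  have \<mu>_nonneg: "0 \<le> \<mu>"
    using \<mu> hermitian_psd_eigenvector(5)[OF A, of _ "complex_of_real \<mu>"] by (auto simp: largest_eigenvalue_def eigenvalue_def)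
  have le: "l2norm (A *\<^sub>v x) \<le> \<rho> * l2norm x" if \<rho>: "\<mu> < \<rho>" for \<rho>
  proof -
    define B where "B = complex_of_real (1 / \<rho>) \<cdot>\<^sub>m A"
    have \<rho>_pos: "0 < \<rho>" using \<rho> \<mu>_nonneg by simp
    have B: "B \<in> carrier_mat n n" using carrier by (simp add: B_def)
    have Bv: "B *\<^sub>v v = complex_of_real (1 / \<rho>) \<cdot>\<^sub>v (A *\<^sub>v v)" if "v \<in> carrier_vec n" for v
      using smult_mat_mult_vec[OF carrier that] by (simp add: B_def)
    have "mat_adjoint B = B"
    proof (rule eq_matI)
      fix i j assume "i < dim_row B" "j < dim_col B"
      then have "i < n" "j < n" using B by auto
      then show "mat_adjoint B $$ (i, j) = B $$ (i, j)"
        using carrier mat_adjoint_index[of i A j, unfolded adj, symmetric]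
        by (simp add: B_def mat_adjoint_index)
    qed (use B in \<open>auto simp: mat_adjoint_def\<close>)
    moreover have "spectral_radius B < 1"
    proof -
      obtain k v where k: "eigenvector B v k" "spectral_radius B = cmod k"
        using spectral_radius_mem_max(1)[OF B n] by (auto simp: spectrum_def eigenvalue_def)
      have v: "v \<in> carrier_vec n" "v \<noteq> 0\<^sub>v n" "B *\<^sub>v v = k \<cdot>\<^sub>v v"
        using k B by (auto simp: eigenvector_def)
      have "A *\<^sub>v v = complex_of_real \<rho> \<cdot>\<^sub>v (B *\<^sub>v v)"
        using \<rho>_pos unfolding Bv[OF v(1)] by (simp add: smult_smult_assoc)
      then have e: "eigenvector A v (\<rho> * k)"
        using v carrier by (auto simp: eigenvector_def smult_smult_assoc)
      define \<nu> where "\<nu> = Re (\<rho> * k)"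
      have \<nu>: "\<rho> * k = complex_of_real \<nu>" "0 \<le> \<nu>"
        using hermitian_psd_eigenvector(4,5)[OF A e] unfolding \<nu>_def by (simp_all only: of_real_Re)
      then have "\<nu> \<le> \<mu>"
        using \<mu> e by (auto simp: largest_eigenvalue_def eigenvalue_def)
      \<comment> \<open>Nonnegativity of eigenvalues is essential: it turns the bound on the value,
        \<open>\<nu> \<le> \<mu>\<close>, into one on the modulus.\<close>
      have "\<rho> * cmod k = \<nu>"
        using arg_cong[OF \<nu>(1), of cmod] \<nu>(2) \<rho>_pos by (simp add: norm_mult)
      with \<open>\<nu> \<le> \<mu>\<close> \<rho> have "\<rho> * cmod k < \<rho> * 1" by simp
      with \<rho>_pos k(2) show ?thesis by simp
    qed
    ultimately have "l2norm (B *\<^sub>v x) \<le> l2norm x"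
      by (intro hermitian_contraction[OF B _ _ x])
    then show ?thesis
      using \<rho>_pos by (simp add: Bv[OF x] norm_divide field_simps)
  qed
  show ?thesis
  proof (rule field_le_epsilon)
    fix e :: real assume "0 < e"
    \<comment> \<open>Dividing by \<open>l2norm x + 1\<close> avoids a separate case for
      \<open>x = 0\<close>; multiplied back by \<open>l2norm x\<close>, the excess is at most
      \<open>e\<close>.\<close>
    have "l2norm (A *\<^sub>v x) \<le> (\<mu> + e / (l2norm x + 1)) * l2norm x"
      using \<open>0 < e\<close> by (intro le) (simp add: add_nonneg_pos)
    also have "\<dots> = \<mu> * l2norm x + e * (l2norm x / (l2norm x + 1))"
      by (simp add: ring_distribs)
    also have "\<dots> \<le> \<mu> * l2norm x + e * 1"
      using \<open>0 < e\<close> by (intro add_left_mono mult_left_mono) (auto simp: divide_le_eq add_nonneg_pos)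
    finally show "l2norm (A *\<^sub>v x) \<le> \<mu> * l2norm x + e" by simp
  qed
qed

text \<open>Cauchy-Schwarz turns the norm bound on \<open>A *\<^sub>v x\<close> into a bound on the
  quadratic form.\<close>

lemma quad_form_le:
  assumes A: "hermitian_psd n A" and n: "n > 0" and \<mu>: "largest_eigenvalue A \<mu>" and x: "x \<in> carrier_vec n"
  shows "Re (quad_form A x) \<le> \<mu> * (l2norm x)\<^sup>2"
proof -
  have "A *\<^sub>v x \<in> carrier_vec n"
    using A x by (auto simp: hermitian_psd_def)
  have "Re (quad_form A x) \<le> cmod (quad_form A x)" by (rule complex_Re_le_cmod)
  also have "\<dots> \<le> l2norm (A *\<^sub>v x) * l2norm x"
    unfolding quad_form_def by (rule cscalar_prod_Cauchy_Schwarz) fact+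
  also have "\<dots> \<le> \<mu> * l2norm x * l2norm x"
    by (intro mult_right_mono hermitian_psd_l2norm_le[OF assms]) simp
  finally show ?thesis by (simp add: power2_eq_square mult.assoc)
qed

lemma quad_form_smult:
  assumes "A \<in> carrier_mat n n" "v \<in> carrier_vec n"
  shows "quad_form A (complex_of_real c \<cdot>\<^sub>v v) = complex_of_real (c\<^sup>2) * quad_form A v"
  using assms by (simp add: quad_form_def mult_mat_vec conjugate_smult_vec power2_eq_square)

text \<open>The scaled eigenvector attains the Rayleigh bound at full radius. Since
  \<open>\<mu>\<close> is nonnegative, shorter vectors cannot do better.\<close>

lemma top_eigenvector_is_arg_max:
  assumes A: "hermitian_psd n A" and n: "n > 0" and v: "unit_top_eigenvector A v" and l: "0 \<le> l"
  shows "is_arg_max (\<lambda>t. Re (quad_form A t)) (\<lambda>t. t \<in> {t \<in> carrier_vec n. (l2norm t)\<^sup>2 \<le> l})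
    (complex_of_real (sqrt l) \<cdot>\<^sub>v v)"
proof -
  obtain \<mu> where \<mu>: "largest_eigenvalue A \<mu>" "eigenvector A v (complex_of_real \<mu>)" and norm: "l2norm v = 1"
    using v by (auto simp: unit_top_eigenvector_def)
  note e = hermitian_psd_eigenvector[OF A \<mu>(2)]
  have carrier: "A \<in> carrier_mat n n"
    using A by (simp add: hermitian_psd_def)
  have val: "Re (quad_form A (complex_of_real (sqrt l) \<cdot>\<^sub>v v)) = \<mu> * l"
    using l unfolding quad_form_smult[OF carrier e(1)] e(3) norm by simp
  have "Re (quad_form A t) \<le> \<mu> * l" if "t \<in> carrier_vec n" "(l2norm t)\<^sup>2 \<le> l" for t
    using quad_form_le[OF A n \<mu>(1) that(1)] mult_left_mono[OF that(2), of \<mu>] e(5) by simp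
  then show ?thesis
    using l e(1) norm by (auto simp: is_arg_max_def val not_less)
qed

section \<open>The chance constraints\<close>

lemma borel_measurable_cnj [measurable]: "cnj \<in> borel_measurable borel"
  by (intro borel_measurable_continuous_onI continuous_intros)

lemma distr_std_complex_normal:
  assumes "prob_space \<Omega>" and Z: "std_complex_normal \<Omega> Z"
  shows "distr \<Omega> borel Z = cgauss"
proof -
  interpret prob_space \<Omega> by fact
  let ?X = "\<lambda>\<omega>. Re (Z \<omega>)" and ?Y = "\<lambda>\<omega>. Im (Z \<omega>)"
  have m[measurable]: "?X \<in> borel_measurable \<Omega>" "?Y \<in> borel_measurable \<Omega>"
    using Z by (auto simp: std_complex_normal_def distributed_def)
  have "distr \<Omega> borel ?X = gauss" "distr \<Omega> borel ?Y = gauss"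
    using Z by (auto simp: std_complex_normal_def distributed_def gauss_def cong: distr_cong)
  then have "gauss \<Otimes>\<^sub>M gauss = distr \<Omega> (borel \<Otimes>\<^sub>M borel) (\<lambda>\<omega>. (?X \<omega>, ?Y \<omega>))"
    using Z by (simp add: std_complex_normal_def indep_var_distribution_eq)
  then show ?thesis
    unfolding cgauss_def by (simp add: distr_distr comp_def)
qed

lemma distr_iid_CN_matrix:
  assumes "prob_space \<Omega>" and H: "iid_CN_matrix \<Omega> n m H" and "0 < n" "0 < m"
  shows "distr \<Omega> (\<Pi>\<^sub>M ij\<in>{..<n} \<times> {..<m}. borel) (\<lambda>\<omega>. \<lambda>ij\<in>{..<n} \<times> {..<m}. H \<omega> $$ ij)
    = (\<Pi>\<^sub>M ij\<in>{..<n} \<times> {..<m}. cgauss)"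
proof -
  interpret prob_space \<Omega> by fact
  let ?I = "{..<n} \<times> {..<m}"
  have iv: "indep_vars (\<lambda>_. borel) (\<lambda>ij \<omega>. H \<omega> $$ ij) ?I"
    using H by (simp add: iid_CN_matrix_def)
  \<comment> \<open>The characterisation of independence by the product law is applied for a
    nonempty index set.\<close>
  have ne: "?I \<noteq> {}" using assms by auto
  have rv: "random_variable borel (\<lambda>\<omega>. H \<omega> $$ ij)" if "ij \<in> ?I" for ij
    using iv that unfolding indep_vars_def by blast
  have "distr \<Omega> (\<Pi>\<^sub>M ij\<in>?I. borel) (\<lambda>\<omega>. \<lambda>ij\<in>?I. H \<omega> $$ ij) = (\<Pi>\<^sub>M ij\<in>?I. distr \<Omega> borel (\<lambda>\<omega>. H \<omega> $$ ij))"
    using indep_vars_iff_distr_eq_PiM'[OF ne, where M' = "\<lambda>_. borel" and X = "\<lambda>ij \<omega>. H \<omega> $$ ij"] rv iv by simp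
  also have "\<dots> = (\<Pi>\<^sub>M ij\<in>?I. cgauss)"
    using H assms(1) by (intro PiM_cong distr_std_complex_normal) (auto simp: iid_CN_matrix_def)
  finally show ?thesis .
qed

text \<open>Rectangles determine the product measure, and on them independence of the generated
  sigma-algebras is the product formula. \<open>X\<close> and \<open>Y\<close> may have different
  types.\<close>

lemma (in prob_space) distr_pair_indep_set:
  assumes X[measurable]: "X \<in> measurable M S" and Y[measurable]: "Y \<in> measurable M T"
    and indep: "indep_set (sets (vimage_algebra (space M) X S)) (sets (vimage_algebra (space M) Y T))"
  shows "distr M (S \<Otimes>\<^sub>M T) (\<lambda>\<omega>. (X \<omega>, Y \<omega>)) = distr M S X \<Otimes>\<^sub>M distr M T Y"
proof (rule pair_measure_eqI[symmetric])
  show "sigma_finite_measure (distr M S X)" "sigma_finite_measure (distr M T Y)"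
    by (auto intro!: prob_space_imp_sigma_finite prob_space_distr)
  fix A B assume "A \<in> sets (distr M S X)" "B \<in> sets (distr M T Y)"
  then have [measurable]: "A \<in> sets S" "B \<in> sets T" by auto
  have "prob ((X -` A \<inter> space M) \<inter> (Y -` B \<inter> space M)) = prob (X -` A \<inter> space M) * prob (Y -` B \<inter> space M)"
    by (intro indep_setD[OF indep] in_vimage_algebra) simp_all
  moreover have "(X -` A \<inter> space M) \<inter> (Y -` B \<inter> space M) = (\<lambda>\<omega>. (X \<omega>, Y \<omega>)) -` (A \<times> B) \<inter> space M"
    by auto
  ultimately show "emeasure (distr M S X) A * emeasure (distr M T Y) B
      = emeasure (distr M (S \<Otimes>\<^sub>M T) (\<lambda>\<omega>. (X \<omega>, Y \<omega>))) (A \<times> B)"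
    by (simp add: emeasure_distr emeasure_eq_measure ennreal_mult)
qed simp

section \<open>Probability of meeting the power threshold\<close>

lemma prob_beamforming_le:
  fixes H :: "'w \<Rightarrow> complex mat" and r :: "'w \<Rightarrow> complex Matrix.vec"
  assumes "prob_space \<Omega>" and H: "iid_CN_matrix \<Omega> n m H" and r: "random_unit_vec \<Omega> n r"
    and indep: "indep_vec_mat \<Omega> n m r H" and nm: "0 < n" "0 < m"
    and t: "t \<in> carrier_vec m" "t \<noteq> 0\<^sub>v m" and c: "0 \<le> c"
  shows "\<P>(\<omega> in \<Omega>. (cmod ((H \<omega> *\<^sub>v t) \<bullet>c r \<omega>))\<^sup>2 \<le> c) = 1 - exp (- c / (l2norm t)\<^sup>2)"
proof -
  interpret prob_space \<Omega> by fact
  let ?I = "{..<n} \<times> {..<m}"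
  let ?PR = "\<Pi>\<^sub>M i\<in>{..<n}. (borel :: complex measure)" and ?PH = "\<Pi>\<^sub>M ij\<in>?I. (borel :: complex measure)"
  \<comment> \<open>\<open>R\<close> and \<open>G\<close> are the restricted families whose
    generated sigma-algebras occur in \<open>indep_vec_mat\<close>; \<open>w\<close> collects the
    coefficients of the channel entries.\<close>
  define R where "R \<omega> = (\<lambda>i\<in>{..<n}. r \<omega> $ i)" for \<omega>
  define G where "G \<omega> = (\<lambda>ij\<in>?I. H \<omega> $$ ij)" for \<omega>
  define w where "w \<rho> ij = cnj (\<rho> (fst ij)) * t $ snd ij" for \<rho> :: "nat \<Rightarrow> complex" and ij :: "nat \<times> nat"
  define f where "f z = (indicator {z. c < (cmod z)\<^sup>2} z :: ennreal)" for z
  have f[measurable]: "f \<in> borel_measurable borel" unfolding f_def by measurable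
  have R[measurable]: "R \<in> measurable \<Omega> ?PR"
    unfolding R_def using r by (intro measurable_restrict) (auto simp: random_unit_vec_def)
  have G[measurable]: "G \<in> measurable \<Omega> ?PH"
    unfolding G_def using H by (intro measurable_restrict) (auto simp: iid_CN_matrix_def indep_vars_def)
  have w_meas: "(\<lambda>\<rho>. w \<rho> ij) \<in> borel_measurable ?PR" if "ij \<in> ?I" for ij
  proof -
    have [measurable]: "(\<lambda>\<rho>. \<rho> (fst ij)) \<in> borel_measurable ?PR"
      using that by (auto intro!: measurable_component_singleton)
    show ?thesis unfolding w_def by measurable
  qed
  have S[measurable]: "(\<lambda>(\<rho>, h). \<Sum>ij\<in>?I. w \<rho> ij * h ij) \<in> borel_measurable (?PR \<Otimes>\<^sub>M ?PH)"
    unfolding case_prod_beta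
  proof (rule borel_measurable_sum)
    fix ij assume ij: "ij \<in> ?I"
    have [measurable]: "(\<lambda>h. h ij) \<in> borel_measurable ?PH" "(\<lambda>\<rho>. w \<rho> ij) \<in> borel_measurable ?PR"
      using ij by (auto intro!: measurable_component_singleton w_meas)
    show "(\<lambda>p. w (fst p) ij * snd p ij) \<in> borel_measurable (?PR \<Otimes>\<^sub>M ?PH)"
      by measurable
  qed
  have W[measurable]: "(\<lambda>\<rho>. \<Sum>ij\<in>?I. (cmod (w \<rho> ij))\<^sup>2) \<in> borel_measurable ?PR"
  proof (rule borel_measurable_sum)
    fix ij assume "ij \<in> ?I"
    note [measurable] = w_meas[OF this]
    show "(\<lambda>\<rho>. (cmod (w \<rho> ij))\<^sup>2) \<in> borel_measurable ?PR" by measurable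
  qed
  have form: "(H \<omega> *\<^sub>v t) \<bullet>c r \<omega> = (\<Sum>ij\<in>?I. w (R \<omega>) ij * G \<omega> ij)" if "\<omega> \<in> space \<Omega>" for \<omega>
  proof -
    have d: "H \<omega> \<in> carrier_mat n m" "r \<omega> \<in> carrier_vec n"
      using H r that by (auto simp: iid_CN_matrix_def random_unit_vec_def)
    have "(H \<omega> *\<^sub>v t) \<bullet>c r \<omega> = (\<Sum>i<n. (\<Sum>j<m. H \<omega> $$ (i, j) * t $ j) * cnj (r \<omega> $ i))"
      using d t by (subst cscalar_prod_eq_sum[of _ n]) (auto simp: scalar_prod_def atLeast0LessThan)
    also have "\<dots> = (\<Sum>i<n. \<Sum>j<m. w (R \<omega>) (i, j) * G \<omega> (i, j))"
      by (auto simp: w_def R_def G_def sum_distrib_left mult_ac intro!: sum.cong)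
    finally show ?thesis by (simp add: sum.cartesian_product)
  qed
  have weight: "(\<Sum>ij\<in>?I. (cmod (w (R \<omega>) ij))\<^sup>2) = (l2norm t)\<^sup>2" if "\<omega> \<in> space \<Omega>" "l2norm (r \<omega>) = 1" for \<omega>
  proof -
    have d: "r \<omega> \<in> carrier_vec n" using r that by (auto simp: random_unit_vec_def)
    have sq: "(l2norm x)\<^sup>2 = (\<Sum>i<k. (cmod (x $ i))\<^sup>2)" if "x \<in> carrier_vec k" for x k
      using that by (simp add: l2norm_def L2_set_def sum_nonneg)
    \<comment> \<open>Each weight is a product of a receive and a transmit factor, so the double sum
      splits into two squared norms.\<close>
    have "(\<Sum>ij\<in>?I. (cmod (w (R \<omega>) ij))\<^sup>2) = (\<Sum>i<n. \<Sum>j<m. (cmod (r \<omega> $ i))\<^sup>2 * (cmod (t $ j))\<^sup>2)"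
      by (auto simp: w_def R_def sum.cartesian_product norm_mult power_mult_distrib intro!: sum.cong)
    also have "\<dots> = (l2norm (r \<omega>))\<^sup>2 * (l2norm t)\<^sup>2"
      by (simp add: sq[OF d] sq[OF t(1)] sum_product)
    finally show ?thesis using that by simp
  qed
  have "l2norm t \<noteq> 0"
    using t l2norm_eq_0_iff by blast
  then have pos: "0 < (l2norm t)\<^sup>2" by simp
  have meas[measurable]: "{\<omega> \<in> space \<Omega>. c < (cmod (\<Sum>ij\<in>?I. w (R \<omega>) ij * G \<omega> ij))\<^sup>2} \<in> events"
    using measurable_compose[OF measurable_Pair[OF R G] S] by simp
  have "emeasure \<Omega> {\<omega> \<in> space \<Omega>. c < (cmod (\<Sum>ij\<in>?I. w (R \<omega>) ij * G \<omega> ij))\<^sup>2}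
      = (\<integral>\<^sup>+\<omega>. f (\<Sum>ij\<in>?I. w (R \<omega>) ij * G \<omega> ij) \<partial>\<Omega>)"
    unfolding nn_integral_indicator[OF meas, symmetric]
    by (intro nn_integral_cong) (simp add: f_def indicator_def)
  also have "\<dots> = (\<integral>\<^sup>+(\<rho>, h). f (\<Sum>ij\<in>?I. w \<rho> ij * h ij) \<partial>distr \<Omega> (?PR \<Otimes>\<^sub>M ?PH) (\<lambda>\<omega>. (R \<omega>, G \<omega>)))"
    using measurable_compose[OF S f] by (subst nn_integral_distr) (auto simp: case_prod_beta)
  also have "distr \<Omega> (?PR \<Otimes>\<^sub>M ?PH) (\<lambda>\<omega>. (R \<omega>, G \<omega>)) = distr \<Omega> ?PR R \<Otimes>\<^sub>M distr \<Omega> ?PH G"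
    using indep R G unfolding indep_vec_mat_def R_def[symmetric] G_def[symmetric]
    by (intro distr_pair_indep_set) (auto simp: R_def[abs_def] G_def[abs_def])
  also have "distr \<Omega> ?PH G = (\<Pi>\<^sub>M ij\<in>?I. cgauss)"
    unfolding G_def by (rule distr_iid_CN_matrix) fact+
  also have "(\<integral>\<^sup>+(\<rho>, h). f (\<Sum>ij\<in>?I. w \<rho> ij * h ij) \<partial>(distr \<Omega> ?PR R \<Otimes>\<^sub>M (\<Pi>\<^sub>M ij\<in>?I. cgauss)))
      = (\<integral>\<^sup>+\<rho>. \<integral>\<^sup>+h. f (\<Sum>ij\<in>?I. w \<rho> ij * h ij) \<partial>(\<Pi>\<^sub>M ij\<in>?I. cgauss) \<partial>distr \<Omega> ?PR R)"
  proof -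
    interpret K: product_prob_space "\<lambda>_. cgauss" ?I ..
    have "sets (distr \<Omega> ?PR R \<Otimes>\<^sub>M (\<Pi>\<^sub>M ij\<in>?I. cgauss)) = sets (?PR \<Otimes>\<^sub>M ?PH)"
      by (intro sets_pair_measure_cong sets_PiM_cong) simp_all
    then have "(\<lambda>(\<rho>, h). f (\<Sum>ij\<in>?I. w \<rho> ij * h ij)) \<in> borel_measurable (distr \<Omega> ?PR R \<Otimes>\<^sub>M (\<Pi>\<^sub>M ij\<in>?I. cgauss))"
      using measurable_compose[OF S f] by (simp add: case_prod_beta cong: measurable_cong_sets)
    from K.P.nn_integral_fst[OF this] show ?thesis by simp
  qed
  also have "\<dots> = (\<integral>\<^sup>+\<rho>. \<integral>\<^sup>+z. f (complex_of_real (sqrt (\<Sum>ij\<in>?I. (cmod (w \<rho> ij))\<^sup>2)) * z) \<partial>cgauss \<partial>distr \<Omega> ?PR R)"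
    by (intro nn_integral_cong nn_integral_PiM_cgauss_sum) simp_all
  also have "\<dots> = (\<integral>\<^sup>+\<omega>. \<integral>\<^sup>+z. f (complex_of_real (sqrt (\<Sum>ij\<in>?I. (cmod (w (R \<omega>) ij))\<^sup>2)) * z) \<partial>cgauss \<partial>\<Omega>)"
    by (intro nn_integral_distr R) simp
  \<comment> \<open>The unit norm of \<open>r\<close> holds only almost everywhere, which is enough
    under the integral. The inner integral no longer depends on the outcome.\<close>
  also have "\<dots> = (\<integral>\<^sup>+\<omega>. \<integral>\<^sup>+z. f (complex_of_real (l2norm t) * z) \<partial>cgauss \<partial>\<Omega>)"
  proof (rule nn_integral_cong_AE)
    have "AE \<omega> in \<Omega>. l2norm (r \<omega>) = 1" using r by (simp add: random_unit_vec_def)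
    then show "AE \<omega> in \<Omega>. (\<integral>\<^sup>+z. f (complex_of_real (sqrt (\<Sum>ij\<in>?I. (cmod (w (R \<omega>) ij))\<^sup>2)) * z) \<partial>cgauss)
        = (\<integral>\<^sup>+z. f (complex_of_real (l2norm t) * z) \<partial>cgauss)"
      using AE_space by eventually_elim (simp add: weight)
  qed
  also have "\<dots> = (\<integral>\<^sup>+z. f (complex_of_real (l2norm t) * z) \<partial>cgauss)"
    by (simp add: emeasure_space_1)
  also have "\<dots> = (\<integral>\<^sup>+z. indicator {z. c / (l2norm t)\<^sup>2 < (cmod z)\<^sup>2} z \<partial>cgauss)"
    using pos by (intro nn_integral_cong)
      (simp add: f_def indicator_def norm_mult power_mult_distrib divide_less_eq mult.commute)
  also have "\<dots> = ennreal (exp (- (c / (l2norm t)\<^sup>2)))"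
    using c pos by (simp add: emeasure_cgauss_tail)
  finally have tail: "prob {\<omega> \<in> space \<Omega>. c < (cmod (\<Sum>ij\<in>?I. w (R \<omega>) ij * G \<omega> ij))\<^sup>2} = exp (- (c / (l2norm t)\<^sup>2))"
    by (simp add: emeasure_eq_measure)
  have "{\<omega> \<in> space \<Omega>. (cmod ((H \<omega> *\<^sub>v t) \<bullet>c r \<omega>))\<^sup>2 \<le> c}
      = space \<Omega> - {\<omega> \<in> space \<Omega>. c < (cmod (\<Sum>ij\<in>?I. w (R \<omega>) ij * G \<omega> ij))\<^sup>2}"
    by (auto simp: form)
  then show ?thesis
    using prob_compl[OF meas] tail by simp
qed

text \<open>For nonzero \<open>t\<close> the constraint says that
  \<open>exp (- (\<epsilon> / \<alpha>) / (l2norm t)\<^sup>2)\<close> is at most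
  \<open>\<delta>\<close>; take logarithms and solve for the squared norm, using
  \<open>ln (1 / \<delta>) > 0\<close>.\<close>

lemma chance_constraint_iff:
  fixes H :: "'w \<Rightarrow> complex mat" and r :: "'w \<Rightarrow> complex Matrix.vec"
  assumes "prob_space \<Omega>" and "iid_CN_matrix \<Omega> n m H" and r: "random_unit_vec \<Omega> n r"
    and "indep_vec_mat \<Omega> n m r H" and "0 < n" "0 < m"
    and t: "t \<in> carrier_vec m" and \<epsilon>: "0 < \<epsilon>" and \<alpha>: "0 < \<alpha>" and \<delta>: "0 < \<delta>" "\<delta> < 1"
  shows "1 - \<delta> \<le> \<P>(\<omega> in \<Omega>. (cmod ((H \<omega> *\<^sub>v t) \<bullet>c r \<omega>))\<^sup>2 \<le> \<epsilon> / \<alpha>)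
    \<longleftrightarrow> (l2norm t)\<^sup>2 \<le> \<epsilon> / (\<alpha> * ln (1 / \<delta>))"
proof (cases "t = 0\<^sub>v m")
  \<comment> \<open>The exponent divides by the squared norm, so \<open>t = 0\<close> is separate:
    the received power vanishes and both sides hold.\<close>
  case True
  interpret prob_space \<Omega> by fact
  have d: "H \<omega> \<in> carrier_mat n m" "r \<omega> \<in> carrier_vec n" if "\<omega> \<in> space \<Omega>" for \<omega>
    using assms that by (auto simp: iid_CN_matrix_def random_unit_vec_def)
  have "(H \<omega> *\<^sub>v t) \<bullet>c r \<omega> = 0" if "\<omega> \<in> space \<Omega>" for \<omega>
  proof -
    have "H \<omega> *\<^sub>v t = 0\<^sub>v n" using d[OF that] True by auto
    then show ?thesis using d[OF that] by simp
  qed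
  then have "{\<omega> \<in> space \<Omega>. (cmod ((H \<omega> *\<^sub>v t) \<bullet>c r \<omega>))\<^sup>2 \<le> \<epsilon> / \<alpha>} = space \<Omega>"
    using \<epsilon> \<alpha> by auto
  moreover have "l2norm t = 0" using t True l2norm_eq_0_iff by blast
  moreover have "0 < ln (1 / \<delta>)" using \<delta> by simp
  ultimately show ?thesis
    using \<epsilon> \<alpha> \<delta> by (simp add: prob_space)
next
  case False
  have pos: "0 < (l2norm t)\<^sup>2"
    using t False l2norm_eq_0_iff by (metis zero_less_power2)
  have ln_pos: "0 < ln (1 / \<delta>)" using \<delta> by simp
  have "1 - \<delta> \<le> 1 - exp (- (\<epsilon> / \<alpha>) / (l2norm t)\<^sup>2) \<longleftrightarrow> exp (- (\<epsilon> / \<alpha>) / (l2norm t)\<^sup>2) \<le> exp (ln \<delta>)"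
    using \<delta> by simp
  also have "\<dots> \<longleftrightarrow> ln (1 / \<delta>) \<le> (\<epsilon> / \<alpha>) / (l2norm t)\<^sup>2"
    unfolding exp_le_cancel_iff using \<delta> by (simp add: ln_div) linarith
  also have "\<dots> \<longleftrightarrow> (l2norm t)\<^sup>2 \<le> \<epsilon> / (\<alpha> * ln (1 / \<delta>))"
    using pos ln_pos \<alpha> by (simp add: pos_le_divide_eq mult_ac)
  finally show ?thesis
    using prob_beamforming_le[OF assms(1-6) t False, of "\<epsilon> / \<alpha>"] \<epsilon> \<alpha> by simp
qed

section \<open>The common feasible ball and the optimal beamformer\<close>

theorem mainTheorem4:
  fixes \<Omega> :: "'w measure" and M K :: nat and N :: "nat \<Rightarrow> nat" and A :: "complex mat"
    and \<epsilon> \<alpha> \<delta> :: "nat \<Rightarrow> real" and P lam :: real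
    and H :: "nat \<Rightarrow> 'w \<Rightarrow> complex mat" and r :: "nat \<Rightarrow> 'w \<Rightarrow> complex Matrix.vec"
  assumes "prob_space \<Omega>"
    and "M \<ge> 1" and "K \<ge> 1" and "\<And>k. k \<in> {1..K} \<Longrightarrow> N k \<ge> 1"
    and "hermitian_psd M A"
    and "\<And>k. k \<in> {1..K} \<Longrightarrow> \<epsilon> k > 0"
    and "\<And>k. k \<in> {1..K} \<Longrightarrow> \<alpha> k > 0"
    and "\<And>k. k \<in> {1..K} \<Longrightarrow> 0 < \<delta> k \<and> \<delta> k < 1"
    and "P > 0"
    and "\<And>k. k \<in> {1..K} \<Longrightarrow> iid_CN_matrix \<Omega> (N k) M (H k)"
    and "\<And>k. k \<in> {1..K} \<Longrightarrow> random_unit_vec \<Omega> (N k) (r k)"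
    and "\<And>k. k \<in> {1..K} \<Longrightarrow> indep_vec_mat \<Omega> (N k) M (r k) (H k)"
    and "lam = Min (insert P ((\<lambda>k. \<epsilon> k / (\<alpha> k * ln (1 / \<delta> k))) ` {1..K}))"
  shows "feasible_set \<Omega> M K r H \<epsilon> \<alpha> \<delta> P = {t \<in> carrier_vec M. (l2norm t)\<^sup>2 \<le> lam}
    \<and> (\<exists>v. unit_top_eigenvector A v)
    \<and> (\<forall>v. unit_top_eigenvector A v \<longrightarrow>
          is_arg_max (\<lambda>t. Re (quad_form A t)) (\<lambda>t. t \<in> feasible_set \<Omega> M K r H \<epsilon> \<alpha> \<delta> P)
            (complex_of_real (sqrt lam) \<cdot>\<^sub>v v))"
proof -
  have M: "0 < M" using assms(2) by simp
  have chance: "1 - \<delta> k \<le> \<P>(\<omega> in \<Omega>. (cmod ((H k \<omega> *\<^sub>v t) \<bullet>c r k \<omega>))\<^sup>2 \<le> \<epsilon> k / \<alpha> k)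
      \<longleftrightarrow> (l2norm t)\<^sup>2 \<le> \<epsilon> k / (\<alpha> k * ln (1 / \<delta> k))"
    if "k \<in> {1..K}" "t \<in> carrier_vec M" for k t
    using assms(4,6,7,8)[OF that(1)] that(2) M
    by (intro chance_constraint_iff[OF assms(1) assms(10-12)[OF that(1)]]) auto
  \<comment> \<open>Lying below a finite minimum means lying below each member, so the
    \<open>K\<close> chance constraints and the power budget merge into one ball.\<close>
  have feasible: "feasible_set \<Omega> M K r H \<epsilon> \<alpha> \<delta> P = {t \<in> carrier_vec M. (l2norm t)\<^sup>2 \<le> lam}"
    unfolding feasible_set_def assms(13) by (auto simp: chance)
  \<comment> \<open>Nonnegativity of \<open>lam\<close> is needed for \<open>sqrt lam\<close> to
    square back to \<open>lam\<close>.\<close>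
  have "0 < \<epsilon> k / (\<alpha> k * ln (1 / \<delta> k))" if "k \<in> {1..K}" for k
    using assms(6-8)[OF that] by (intro divide_pos_pos mult_pos_pos) auto
  then have "0 \<le> lam"
    using assms(9) unfolding assms(13) by (auto simp: less_imp_le)
  then show ?thesis
    using feasible unit_top_eigenvector_exists[OF assms(5) M] top_eigenvector_is_arg_max[OF assms(5) M]
    by simp
qed

end
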